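(* Let $k\ge 1$ be a fixed integer. For each integer $d\ge 2k+4$ let $\Delta=\Delta_d$ be a $(d-1)$-dimensional simplicial sphere satisfying the link condition with $\gamma(\Delta)\ge 0$, and suppose $d=o(g_1(\Delta))$ as $d\to\infty$. (1) We have $$\lim_{d\to+\infty}\frac{1}{f_1(\Delta)}\frac{\mathcal C_k}{g_{k+1}(\Delta)}=\lim_{d\to+\infty}\frac12\cdot\frac{(k+1)(k+2)\frac{g_{k+2}(\Delta)}{g_{k+1}(\Delta)}}{f_1(\Delta)},$$ in the sense that if one of the limits exists then so does the other and they are equal. (2) If $\frac{g_{k+1}(\Delta)}{g_k(\Delta)}=o\left(\frac{f_1(\Delta)}{d^2}\right)$ as $d\to\infty$, then for all sufficiently large $d$ the inequality $$1-\frac{1}{f_1(\Delta)}\frac{\mathcal C_k}{g_{k+1}(\Delta)}\le f_1(\Delta)^{\frac1k}\,\frac{g_k(\Delta)^{\frac{k+1}{k}}}{g_{k+1}(\Delta)}\left(1-\frac{1}{f_1(\Delta)}\frac{\mathcal C_{k-1}}{g_k(\Delta)}\right)^{\frac{k+1}{k}}\qquad( * )$$ is already implied by the $M$-vector inequalities $0\le g_{i+1}(\Delta)\le g_i(\Delta)^{\langle i\rangle}$ of $\Delta$; that is, for every sequence of $(d-1)$-dimensional simplicial spheres $\Delta_d$ (whether or not they satisfy the link condition) with $\gamma(\Delta_d)\ge 0$, $d=o(g_1(\Delta_d))$ and $\frac{g_{k+1}(\Delta_d)}{g_k(\Delta_d)}=o\left(\frac{f_1(\Delta_d)}{d^2}\right)$,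 inequality $( * )$ holds for all sufficiently large $d$.
   Context: For a $(d-1)$-dimensional simplicial complex $\Delta$, $f_i(\Delta)$ is the number of $i$-dimensional faces ($f_{-1}=1$); $h_j(\Delta)=\sum_{i=0}^j(-1)^{j-i}\binom{d-i}{j-i}f_{i-1}(\Delta)$; $g_0=1$, $g_i=h_i-h_{i-1}$ for $1\le i\le\lfloor d/2\rfloor$. One has $f_1(\Delta)=\binom{d+1}2+d g_1(\Delta)+g_2(\Delta)$. "Simplicial sphere" means PL simplicial sphere (so $h_i=h_{d-i}$). The gamma vector $\gamma(\Delta)=(\gamma_0,\dots,\gamma_{\lfloor d/2\rfloor})$ is defined by $\sum_i h_i(\Delta) x^i=\sum_{i}\gamma_i x^i(1+x)^{d-2i}$, and $\gamma(\Delta)\ge0$ means all $\gamma_i\ge0$. The link condition: $\mathrm{lk}_\Delta(a)\cap\mathrm{lk}_\Delta(b)=\mathrm{lk}_\Delta(\{a,b\})$ for every edge $\{a,b\}$, where $\mathrm{lk}_\Delta(F)=\{G\in\Delta:G\cup F\in\Delta,G\cap F=\emptyset\}$. For $k+2\le d/2$, $$\mathcal C_k=\tfrac12\left[(k+1)(k+2)g_{k+2}(\Delta)+2(k+1)(d-k)g_{k+1}(\Delta)+(d-k)(d-k+1)g_k(\Delta)\right],$$ which equals $\sum_{e\in\Delta,|e|=2}g_k(\mathrm{lk}_\Delta(e))$. For a positive integer $a$ and $k\ge1$ with Macaulay representation $a=\binom{n_k}{k}+\dots+\binom{n_j}{j}$, $n_k>\dots>n_j\ge j\ge1$, put $a^{\langle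 k\rangle}=\binom{n_k+1}{k+1}+\dots+\binom{n_j+1}{j+1}$, $0^{\langle k\rangle}=0$. The inequality $( * )$ is the "global/averaged" version (obtained by summing over all edges $e$) of the $M$-vector inequalities $g_{k+1}(\widetilde\Delta_e)\le g_k(\widetilde\Delta_e)^{\langle k\rangle}$ for edge contractions $\widetilde\Delta_e$. Asymptotic notation is as $d\to\infty$. *)

theory Defs
  imports "HOL-Analysis.Analysis" "HOL-Analysis.Finite_Function_Topology"
    "HOL-Computational_Algebra.Polynomial" "HOL-Library.Landau_Symbols"
begin

section \<open>Abstract simplicial complexes\<close>

text \<open>The empty face belongs to every complex; the vertices are the \<open>v\<close> with \<open>{v} \<in> \<Delta>\<close>.\<close>

definition abstract_complex :: "'a set set \<Rightarrow> bool" where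
  "abstract_complex \<Delta> \<longleftrightarrow>
     finite \<Delta> \<and> {} \<in> \<Delta> \<and> (\<forall>F\<in>\<Delta>. finite F \<and> (\<forall>G. G \<subseteq> F \<longrightarrow> G \<in> \<Delta>))"

definition link :: "'a set set \<Rightarrow> 'a set \<Rightarrow> 'a set set" where
  "link \<Delta> F = {G \<in> \<Delta>. G \<union> F \<in> \<Delta> \<and> G \<inter> F = {}}"

definition link_condition :: "'a set set \<Rightarrow> bool" where
  "link_condition \<Delta> \<longleftrightarrow>
     (\<forall>a b. a \<noteq> b \<and> {a, b} \<in> \<Delta> \<longrightarrow> link \<Delta> {a} \<inter> link \<Delta> {b} = link \<Delta> {a, b})"

definition simplex_boundary :: "nat \<Rightarrow> nat set set" where
  "simplex_boundary n = {F. F \<subset> {..n}}"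


section \<open>PL spheres\<close>

text \<open>The library constant \<open>simplicial_complex\<close> is restricted to Euclidean spaces, whose dimension
  is fixed by the type. The following is the same notion in an arbitrary real vector space.\<close>

definition geometric_complex :: "'v::real_vector set set \<Rightarrow> bool" where
  "geometric_complex K \<longleftrightarrow>
     finite K \<and>
     (\<forall>S\<in>K. \<exists>V. finite V \<and> \<not> affine_dependent V \<and> S = convex hull V) \<and>
     (\<forall>F S. S \<in> K \<and> F face_of S \<longrightarrow> F \<in> K) \<and>
     (\<forall>S S'. S \<in> K \<and> S' \<in> K \<longrightarrow> (S \<inter> S') face_of S)"

text \<open>The standard geometric realization: a vertex \<open>v\<close> becomes the basis vector \<open>e\<^sub>v\<close> of
  the free real vector space on the vertices.\<close>

definition realization :: "'a set set \<Rightarrow> ('a \<Rightarrow>\<^sub>0 real) set set" where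
  "realization \<Delta> = (\<lambda>F. convex hull ((\<lambda>v. Poly_Mapping.single v 1) ` F)) ` \<Delta>"

definition subdivision :: "'v::real_vector set set \<Rightarrow> 'v set set \<Rightarrow> bool" where
  "subdivision K' K \<longleftrightarrow>
     geometric_complex K' \<and> \<Union>K' = \<Union>K \<and> (\<forall>S'\<in>K'. \<exists>S\<in>K. S' \<subseteq> S)"

definition affine_map_on :: "'v::real_vector set \<Rightarrow> ('v \<Rightarrow> 'w::real_vector) \<Rightarrow> bool" where
  "affine_map_on S f \<longleftrightarrow>
     (\<forall>x\<in>S. \<forall>y\<in>S. \<forall>u\<in>{0..1}. f ((1 - u) *\<^sub>R x + u *\<^sub>R y) = (1 - u) *\<^sub>R f x + u *\<^sub>R f y)"

definition pl_map_on :: "'v::real_vector set set \<Rightarrow> ('v \<Rightarrow> 'w::real_vector) \<Rightarrow> bool" where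
  "pl_map_on K f \<longleftrightarrow> (\<exists>K'. subdivision K' K \<and> (\<forall>S\<in>K'. affine_map_on S f))"

definition pl_homeomorphic ::
    "'v::real_normed_vector set set \<Rightarrow> 'w::real_normed_vector set set \<Rightarrow> bool" where
  "pl_homeomorphic K L \<longleftrightarrow>
     (\<exists>f g. homeomorphism (\<Union>K) (\<Union>L) f g \<and> pl_map_on K f \<and> pl_map_on L g)"

text \<open>An \<open>n\<close>-dimensional PL simplicial sphere: its realization is PL homeomorphic to the boundary
  of the \<open>(n+1)\<close>-simplex.\<close>

definition simplicial_sphere :: "nat \<Rightarrow> 'a set set \<Rightarrow> bool" where
  "simplicial_sphere n \<Delta> \<longleftrightarrow>
     abstract_complex \<Delta> \<and>
     pl_homeomorphic (realization \<Delta>) (realization (simplex_boundary (n + 1)))"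


section \<open>Face numbers\<close>

text \<open>The parameter \<open>d\<close> below is one more than the dimension of \<open>\<Delta>\<close>.\<close>

definition f_num :: "'a set set \<Rightarrow> int \<Rightarrow> nat" where
  "f_num \<Delta> i = card {F \<in> \<Delta>. int (card F) = i + 1}"

definition h_num :: "nat \<Rightarrow> 'a set set \<Rightarrow> nat \<Rightarrow> int" where
  "h_num d \<Delta> j =
     (\<Sum>i\<le>j. (-1) ^ (j - i) * int ((d - i) choose (j - i)) * int (f_num \<Delta> (int i - 1)))"

definition g_num :: "nat \<Rightarrow> 'a set set \<Rightarrow> nat \<Rightarrow> int" where
  "g_num d \<Delta> i = (if i = 0 then 1 else h_num d \<Delta> i - h_num d \<Delta> (i - 1))"

text \<open>As the polynomials \<open>x\<^sup>i (1 + x)\<^bsup>d - 2i\<^esup>\<close> are linearly independent, the entries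
  \<open>\<gamma> 0, \<dots>, \<gamma> (d div 2)\<close> are determined by \<open>\<Delta>\<close>; they exist because \<open>h\<^sub>i = h\<^bsub>d - i\<^esub>\<close> holds for
  spheres.\<close>

definition is_gamma_vector :: "nat \<Rightarrow> 'a set set \<Rightarrow> (nat \<Rightarrow> int) \<Rightarrow> bool" where
  "is_gamma_vector d \<Delta> \<gamma> \<longleftrightarrow>
     (\<Sum>i\<le>d. monom (h_num d \<Delta> i) i) =
     (\<Sum>i\<le>d div 2. smult (\<gamma> i) (monom 1 i * [:1, 1:] ^ (d - 2 * i)))"

definition gamma_nonneg :: "nat \<Rightarrow> 'a set set \<Rightarrow> bool" where
  "gamma_nonneg d \<Delta> \<longleftrightarrow> (\<exists>\<gamma>. is_gamma_vector d \<Delta> \<gamma> \<and> (\<forall>i\<le>d div 2. \<gamma> i \<ge> 0))"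

definition C_num :: "nat \<Rightarrow> 'a set set \<Rightarrow> nat \<Rightarrow> real" where
  "C_num d \<Delta> k =
     1 / 2 * ((real k + 1) * (real k + 2) * g_num d \<Delta> (k + 2)
            + 2 * (real k + 1) * (real d - real k) * g_num d \<Delta> (k + 1)
            + (real d - real k) * (real d - real k + 1) * g_num d \<Delta> k)"

end

theory Submission
  imports Defs
begin

text \<open>No sphere topology enters. Expanding \<open>g\<^sub>j\<close> in the \<open>\<gamma>\<^sub>i\<close>, each coefficient is a difference of
  consecutive binomial coefficients, and comparing these termwise gives
  \<open>(d - 2j - 1) g\<^sub>j \<le> (j + 1) g\<^bsub>j+1\<^esub>\<close>. Together with \<open>f\<^sub>1 \<ge> d\<^sup>2/2\<close> this makes the last two terms of
  \<open>C\<^sub>k / (f\<^sub>1 g\<^bsub>k+1\<^esub>)\<close> vanish in the limit.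

  For (*), the growth estimate also makes \<open>f\<^bsub>k-1\<^esub>\<close> at most a constant times \<open>g\<^sub>k\<close>, so the
  Kruskal--Katona type bound \<open>f\<^sub>k\<^sup>k \<le> f\<^bsub>k-1\<^esub>\<^bsup>k+1\<^esup>\<close>, valid for every complex, yields
  \<open>g\<^bsub>k+1\<^esub> \<le> B g\<^sub>k\<^bsup>(k+1)/k\<^esup>\<close> with \<open>B\<close> depending on \<open>k\<close> only. This replaces the \<open>M\<close>-vector
  inequality, because the factor \<open>f\<^sub>1\<^bsup>1/k\<^esup>\<close> on the right of (*) tends to infinity.\<close>

section \<open>Face numbers, h-numbers and the gamma expansion\<close>

lemma coeff_one_plus_x_power: "coeff ([:1, 1:] ^ n) m = (of_nat (n choose m) :: 'a::comm_semiring_1)"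
proof (induction n arbitrary: m)
  case 0
  show ?case by (cases m) auto
next
  case (Suc n)
  then show ?case by (cases m) (auto simp: add.commute)
qed

lemma f_num_int_minus_one: "f_num \<Delta> (int j - 1) = card {F \<in> \<Delta>. card F = j}"
  by (simp add: f_num_def)

lemma f_num_minus_one:
  assumes "abstract_complex \<Delta>"
  shows "f_num \<Delta> (- 1) = 1"
proof -
  have "{F \<in> \<Delta>. card F = 0} = {{}}"
    using assms by (auto simp: abstract_complex_def)
  then show ?thesis
    using f_num_int_minus_one[of \<Delta> 0] by simp
qed

text \<open>Unfold h_1 and h_2 and solve for f_1. Positivity of g_1 and g_2 will turn this into a
  quadratic lower bound for f_1.\<close>

lemma f_num_1_eq:
  assumes "abstract_complex \<Delta>" "d \<ge> 2"
  shows "int (f_num \<Delta> 1) = g_num d \<Delta> 2 + int d * g_num d \<Delta> 1 + int ((d + 1) choose 2)"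
proof -
  obtain e where d: "d = e + 2"
    using assms(2) by (metis add.commute le_Suc_ex)
  \<comment> \<open>Doubling the binomials clears the division by two in
    \<open>choose_two\<close>.\<close>
  have "int (2 * (d choose 2)) = int d * (int d - 1)" "int (2 * ((d + 1) choose 2)) = int d * (int d + 1)"
    unfolding d choose_two by (simp_all add: algebra_simps)
  then show ?thesis
    using d by (simp add: g_num_def h_num_def numeral_2_eq_2 f_num_minus_one[OF assms(1)] algebra_simps)
qed

text \<open>Comparison of the coefficients of x^j in the identity defining the gamma vector. Without
  the guard \<open>i \<le> j\<close>, the truncated \<open>j - i\<close> would be 0 and contribute a
  spurious 1.\<close>

lemma h_num_eq_sum_gamma:
  assumes "is_gamma_vector d \<Delta> \<gamma>" "j \<le> d"
  shows "h_num d \<Delta> j =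
    (\<Sum>i\<le>d div 2. \<gamma> i * (if i \<le> j then int ((d - 2 * i) choose (j - i)) else 0))"
proof -
  have "h_num d \<Delta> j = coeff (\<Sum>i\<le>d. monom (h_num d \<Delta> i) i) j"
    using assms(2) by (simp add: coeff_sum)
  also have "\<dots> = coeff (\<Sum>i\<le>d div 2. smult (\<gamma> i) (monom 1 i * [:1, 1:] ^ (d - 2 * i))) j"
    using assms(1) by (simp add: is_gamma_vector_def)
  finally show ?thesis
    by (auto simp: coeff_sum coeff_monom_mult coeff_one_plus_x_power intro!: sum.cong)
qed

section \<open>Growth of the g-numbers under a nonnegative gamma vector\<close>

text \<open>Here \<open>w j\<close> is the coefficient of gamma_i in h_j. For n = d - 2i and m = j -
  i, absorption gives (m+1)(C(n,m+1) - C(n,m)) = (n-2m-1) C(n,m), and n - 2m = d - 2j does not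
  depend on i. It remains to drop the subtracted \<open>w (j - 1)\<close> on the left and to enlarge
  m+1 to j+1 on the right.\<close>

lemma binomial_difference_growth:
  fixes d i j :: nat
  defines "w \<equiv> \<lambda>j. if i \<le> j then int ((d - 2 * i) choose (j - i)) else 0"
  assumes "2 * j + 2 \<le> d"
  shows "(int d - 2 * int j - 1) * (if j = 0 then w 0 else w j - w (j - 1))
           \<le> (int j + 1) * (w (j + 1) - w j)"
proof (cases "i \<le> j")
  case True
  define n m where "n = d - 2 * i" and "m = j - i"
  have nm: "int n - 2 * int m = int d - 2 * int j" "m \<le> j" "m \<le> n"
    using True assms(2) by (auto simp: n_def m_def)
  have "Suc m * (n choose Suc m) = (n - m) * (n choose m)"
    by (simp only: binomial_absorption binomial_absorb_comp)
  then have "(int m + 1) * int (n choose Suc m) = (int n - int m) * int (n choose m)"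
    using nm(3) by (metis of_nat_Suc of_nat_diff of_nat_mult add.commute)
  then have eq: "(int m + 1) * (int (n choose Suc m) - int (n choose m))
      = (int d - 2 * int j - 1) * int (n choose m)"
    unfolding nm(1)[symmetric] by (simp add: algebra_simps)
  have pos: "int d - 2 * int j - 1 > 0"
    using assms(2) by simp
  \<comment> \<open>By the identity the binomials do not decrease from m to m+1; this sign is what
    permits replacing m+1 by j+1.\<close>
  have "0 \<le> (int m + 1) * (int (n choose Suc m) - int (n choose m))"
    unfolding eq using pos by simp
  then have nonneg: "0 \<le> int (n choose Suc m) - int (n choose m)"
    by (simp add: zero_le_mult_iff)
  have "(int d - 2 * int j - 1) * (if j = 0 then w 0 else w j - w (j - 1))
      \<le> (int d - 2 * int j - 1) * w j"
    using pos by (intro mult_left_mono) (auto simp: w_def)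
  also have "\<dots> = (int m + 1) * (int (n choose Suc m) - int (n choose m))"
    using True unfolding eq by (simp add: w_def n_def m_def)
  also have "\<dots> \<le> (int j + 1) * (int (n choose Suc m) - int (n choose m))"
    using nonneg nm(2) by (intro mult_right_mono) auto
  also have "\<dots> = (int j + 1) * (w (j + 1) - w j)"
    using True by (simp add: w_def n_def m_def Suc_diff_le)
  finally show ?thesis .
next
  \<comment> \<open>For i > j the left side is 0, and on the right only \<open>w (j + 1)\<close> can
    be nonzero.\<close>
  case False
  then show ?thesis by (auto simp: w_def)
qed

lemma g_num_growth:
  assumes "abstract_complex \<Delta>" "gamma_nonneg d \<Delta>" "2 * j + 2 \<le> d"
  shows "(int d - 2 * int j - 1) * g_num d \<Delta> j \<le> (int j + 1) * g_num d \<Delta> (j + 1)"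
proof -
  from assms(2) obtain \<gamma> where \<gamma>: "is_gamma_vector d \<Delta> \<gamma>" "\<And>i. i \<le> d div 2 \<Longrightarrow> \<gamma> i \<ge> 0"
    unfolding gamma_nonneg_def by blast
  define w where "w i j = (if i \<le> j then int ((d - 2 * i) choose (j - i)) else 0)" for i j
  have h: "h_num d \<Delta> t = (\<Sum>i\<le>d div 2. \<gamma> i * w i t)" if "t \<le> d" for t
    using h_num_eq_sum_gamma[OF \<gamma>(1) that] by (simp add: w_def)
  \<comment> \<open>The convention g_0 = 1 agrees with h_0, so the expansion below also covers
    \<open>t = 0\<close>.\<close>
  have h0: "h_num d \<Delta> 0 = 1"
    using assms(1) by (simp add: h_num_def f_num_minus_one)
  have g: "g_num d \<Delta> t = (\<Sum>i\<le>d div 2. \<gamma> i * (if t = 0 then w i 0 else w i t - w i (t - 1)))"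
    if "t \<le> d" for t
    using h[of t] h[of "t - 1"] h0 that by (auto simp: g_num_def right_diff_distrib sum_subtractf)
  have "(int d - 2 * int j - 1) * g_num d \<Delta> j
      = (\<Sum>i\<le>d div 2. \<gamma> i * ((int d - 2 * int j - 1) * (if j = 0 then w i 0 else w i j - w i (j - 1))))"
    using assms(3) by (simp add: g sum_distrib_left mult.left_commute)
  also have "\<dots> \<le> (\<Sum>i\<le>d div 2. \<gamma> i * ((int j + 1) * (w i (j + 1) - w i j)))"
    using \<gamma>(2) binomial_difference_growth[OF assms(3), folded w_def]
    by (intro sum_mono mult_left_mono) simp_all
  also have "\<dots> = (int j + 1) * g_num d \<Delta> (j + 1)"
    using assms(3) by (simp add: g sum_distrib_left mult.left_commute)
  finally show ?thesis .
qed

text \<open>Starting from g_0 = 1, the growth inequality carries positivity upwards, since d - 2j -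
  1 > 0 as long as 2(j+1) \<le> d.\<close>

lemma g_num_pos:
  assumes "abstract_complex \<Delta>" "gamma_nonneg d \<Delta>" "2 * j \<le> d"
  shows "g_num d \<Delta> j > 0"
  using assms(3)
proof (induction j)
  case 0
  then show ?case by (simp add: g_num_def)
next
  case (Suc j)
  then have "0 < (int d - 2 * int j - 1) * g_num d \<Delta> j"
    by simp
  also have "\<dots> \<le> (int j + 1) * g_num d \<Delta> (j + 1)"
    using Suc.prems by (intro g_num_growth[OF assms(1,2)]) simp
  finally show ?case by (simp add: zero_less_mult_iff)
qed

text \<open>For 4j + 2 \<le> d the factor d - 2j - 1 is at least d/2, so each step up in the index
  gains a factor of order d.\<close>

lemma g_num_growth_real:
  assumes "abstract_complex \<Delta>" "gamma_nonneg d \<Delta>" "4 * j + 2 \<le> d"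
  shows "real d * g_num d \<Delta> j \<le> 2 * (real j + 1) * g_num d \<Delta> (j + 1)"
proof -
  have "int d \<le> 2 * (int d - 2 * int j - 1)" using assms(3) by simp
  then have "int d * g_num d \<Delta> j \<le> 2 * (int d - 2 * int j - 1) * g_num d \<Delta> j"
    using g_num_pos[OF assms(1,2), of j] assms(3) by (intro mult_right_mono) auto
  also have "\<dots> \<le> 2 * ((int j + 1) * g_num d \<Delta> (j + 1))"
    unfolding mult.assoc using assms(3) by (intro mult_left_mono g_num_growth assms(1,2)) auto
  finally have "real_of_int (int d * g_num d \<Delta> j) \<le> real_of_int (2 * ((int j + 1) * g_num d \<Delta> (j + 1)))"
    by (simp only: of_int_le_iff)
  then show ?thesis by (simp add: algebra_simps)
qed

text \<open>Iterates the previous bound by downward induction from i = j; \<open>2 * real j\<close>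
  dominates every constant 2(n+1) with n < j. The hypothesis on d is the one needed at the last
  index n = j - 1.\<close>

lemma g_num_power_growth:
  assumes "abstract_complex \<Delta>" "gamma_nonneg d \<Delta>" "4 * j \<le> d + 2" "i \<le> j"
  shows "real d ^ (j - i) * g_num d \<Delta> i \<le> (2 * real j) ^ (j - i) * g_num d \<Delta> j"
  using assms(4)
proof (induction rule: inc_induct)
  case base
  show ?case by simp
next
  case (step n)
  have d: "4 * n + 2 \<le> d" using step.hyps assms(3) by simp
  have "0 < g_num d \<Delta> (n + 1)"
    using d step.hyps assms(3) by (intro g_num_pos[OF assms(1,2)]) simp
  then have "2 * (real n + 1) * g_num d \<Delta> (n + 1) \<le> 2 * real j * g_num d \<Delta> (n + 1)"
    using step.hyps by (intro mult_right_mono) auto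
  then have "real d * g_num d \<Delta> n \<le> 2 * real j * g_num d \<Delta> (Suc n)"
    using g_num_growth_real[OF assms(1,2) d] by simp
  then have "real d ^ (j - Suc n) * (real d * g_num d \<Delta> n)
      \<le> real d ^ (j - Suc n) * (2 * real j * g_num d \<Delta> (Suc n))"
    by (intro mult_left_mono) auto
  also have "\<dots> = 2 * real j * (real d ^ (j - Suc n) * g_num d \<Delta> (Suc n))"
    by simp
  also have "\<dots> \<le> 2 * real j * ((2 * real j) ^ (j - Suc n) * g_num d \<Delta> j)"
    using step.IH by (intro mult_left_mono) auto
  finally show ?case
    using step.hyps by (simp add: Suc_diff_Suc[symmetric] mult_ac)
qed

section \<open>Bounding face numbers by g-numbers\<close>

lemma sum_g_num:
  assumes "abstract_complex \<Delta>"
  shows "(\<Sum>i\<le>j. g_num d \<Delta> i) = h_num d \<Delta> j"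
proof (induction j)
  case 0
  show ?case using assms by (simp add: g_num_def h_num_def f_num_minus_one)
next
  case (Suc j)
  then show ?case by (simp add: g_num_def)
qed

text \<open>The summand i = j of h_j is f_(j-1) itself; the others are estimated by the triangle
  inequality and C(d-i, j-i) \<le> d^(j-i).\<close>

lemma h_num_f_num_diff:
  "\<bar>real_of_int (h_num d \<Delta> j) - real (f_num \<Delta> (int j - 1))\<bar>
     \<le> (\<Sum>i<j. real d ^ (j - i) * real (f_num \<Delta> (int i - 1)))"
proof -
  have "h_num d \<Delta> j - int (f_num \<Delta> (int j - 1))
      = (\<Sum>i<j. (-1) ^ (j - i) * int ((d - i) choose (j - i)) * int (f_num \<Delta> (int i - 1)))"
    by (simp add: h_num_def flip: lessThan_Suc_atMost)
  then have "\<bar>real_of_int (h_num d \<Delta> j - int (f_num \<Delta> (int j - 1)))\<bar>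
      = \<bar>\<Sum>i<j. (-1) ^ (j - i) * real ((d - i) choose (j - i)) * real (f_num \<Delta> (int i - 1))\<bar>"
    by simp
  also have "\<dots> \<le> (\<Sum>i<j. \<bar>(-1) ^ (j - i) * real ((d - i) choose (j - i)) * real (f_num \<Delta> (int i - 1))\<bar>)"
    by (rule sum_abs)
  also have "\<dots> \<le> (\<Sum>i<j. real d ^ (j - i) * real (f_num \<Delta> (int i - 1)))"
  proof (rule sum_mono)
    fix i assume "i \<in> {..<j}"
    have "(d - i) choose (j - i) \<le> d ^ (j - i)"
    proof (cases "j - i \<le> d - i")
      case True
      then have "(d - i) choose (j - i) \<le> (d - i) ^ (j - i)" by (rule binomial_le_pow)
      also have "\<dots> \<le> d ^ (j - i)" by (rule power_mono) auto
      finally show ?thesis .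
    qed (simp add: binomial_eq_0)
    then have "real ((d - i) choose (j - i)) \<le> real d ^ (j - i)"
      by (metis of_nat_le_iff of_nat_power)
    then show "\<bar>(-1) ^ (j - i) * real ((d - i) choose (j - i)) * real (f_num \<Delta> (int i - 1))\<bar>
        \<le> real d ^ (j - i) * real (f_num \<Delta> (int i - 1))"
      by (simp add: abs_mult power_abs mult_right_mono)
  qed
  finally show ?thesis by simp
qed

text \<open>Strong induction: f_(j-1) is at most h_j plus the terms d^(j-i) f_(i-1) with i < j. The
  former is a sum of g_i, the latter are controlled by d^(j-i) g_i, and both are absorbed by g_j
  through power growth. The constant depends on j only.\<close>

lemma f_num_le_g_num:
  "\<exists>A\<ge>0 :: real. \<forall>d (\<Delta> :: 'a set set). abstract_complex \<Delta> \<and> gamma_nonneg d \<Delta> \<and> 4 * j \<le> d + 2 \<longrightarrow>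
     real (f_num \<Delta> (int j - 1)) \<le> A * g_num d \<Delta> j"
proof (induction j rule: less_induct)
  case (less j)
  then obtain A where A: "\<And>i. i < j \<Longrightarrow> A i \<ge> (0::real)"
    "\<And>i d \<Delta>. i < j \<Longrightarrow> abstract_complex (\<Delta> :: 'a set set) \<Longrightarrow> gamma_nonneg d \<Delta> \<Longrightarrow> 4 * i \<le> d + 2 \<Longrightarrow>
       real (f_num \<Delta> (int i - 1)) \<le> A i * g_num d \<Delta> i"
    by metis
  \<comment> \<open>The first sum accounts for h_j, the second for the lower face numbers.\<close>
  define B where "B = (\<Sum>i\<le>j. (2 * real j) ^ (j - i)) + (\<Sum>i<j. A i * (2 * real j) ^ (j - i))"
  have "real (f_num \<Delta> (int j - 1)) \<le> B * g_num d \<Delta> j"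
    if \<Delta>: "abstract_complex \<Delta>" "gamma_nonneg d \<Delta>" and d: "4 * j \<le> d + 2" for d and \<Delta> :: "'a set set"
  proof (cases "j = 0")
    case True
    then show ?thesis
      using \<Delta> by (simp add: B_def f_num_minus_one g_num_def)
  next
    case False
    then have d1: "real d \<ge> 1" using d by simp
    have growth: "real d ^ (j - i) * g_num d \<Delta> i \<le> (2 * real j) ^ (j - i) * g_num d \<Delta> j" if "i \<le> j" for i
      using g_num_power_growth[OF \<Delta> d that] .
    have pos: "g_num d \<Delta> i > 0" if "i \<le> j" for i
      using that d False by (intro g_num_pos[OF \<Delta>]) linarith
    have "real_of_int (h_num d \<Delta> j) = (\<Sum>i\<le>j. real_of_int (g_num d \<Delta> i))"
      using sum_g_num[OF \<Delta>(1), of d j] by (metis of_int_sum)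
    also have "\<dots> \<le> (\<Sum>i\<le>j. (2 * real j) ^ (j - i) * g_num d \<Delta> j)"
    proof (rule sum_mono)
      fix i assume i: "i \<in> {..j}"
      have "1 * real_of_int (g_num d \<Delta> i) \<le> real d ^ (j - i) * g_num d \<Delta> i"
        using d1 pos[of i] i by (intro mult_right_mono one_le_power) auto
      then show "real_of_int (g_num d \<Delta> i) \<le> (2 * real j) ^ (j - i) * g_num d \<Delta> j"
        using growth[of i] i by simp
    qed
    finally have 1: "real_of_int (h_num d \<Delta> j) \<le> (\<Sum>i\<le>j. (2 * real j) ^ (j - i)) * g_num d \<Delta> j"
      by (simp add: sum_distrib_right)
    have "(\<Sum>i<j. real d ^ (j - i) * real (f_num \<Delta> (int i - 1)))
        \<le> (\<Sum>i<j. A i * (2 * real j) ^ (j - i) * g_num d \<Delta> j)"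
    proof (rule sum_mono)
      fix i assume i: "i \<in> {..<j}"
      have "real d ^ (j - i) * real (f_num \<Delta> (int i - 1)) \<le> real d ^ (j - i) * (A i * g_num d \<Delta> i)"
        using i d \<Delta> by (intro mult_left_mono A(2)) auto
      also have "\<dots> = A i * (real d ^ (j - i) * g_num d \<Delta> i)" by simp
      also have "\<dots> \<le> A i * ((2 * real j) ^ (j - i) * g_num d \<Delta> j)"
        using A(1) i growth by (intro mult_left_mono) auto
      finally show "real d ^ (j - i) * real (f_num \<Delta> (int i - 1)) \<le> A i * (2 * real j) ^ (j - i) * g_num d \<Delta> j"
        by simp
    qed
    then have "(\<Sum>i<j. real d ^ (j - i) * real (f_num \<Delta> (int i - 1)))
        \<le> (\<Sum>i<j. A i * (2 * real j) ^ (j - i)) * g_num d \<Delta> j"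
      by (simp add: sum_distrib_right)
    with 1 h_num_f_num_diff[of d \<Delta> j] show ?thesis
      by (simp add: B_def distrib_right)
  qed
  moreover have "B \<ge> 0"
    unfolding B_def using A(1) by (intro add_nonneg_nonneg sum_nonneg mult_nonneg_nonneg) auto
  ultimately show ?case by blast
qed

section \<open>A Kruskal-Katona type bound through vertex links\<close>

lemma abstract_complex_link:
  assumes "abstract_complex \<Delta>" "F \<in> \<Delta>"
  shows "abstract_complex (link \<Delta> F)"
  unfolding abstract_complex_def
proof (intro conjI ballI allI impI)
  show "finite (link \<Delta> F)"
    using assms(1) by (auto simp: abstract_complex_def link_def)
  show "{} \<in> link \<Delta> F"
    using assms by (auto simp: abstract_complex_def link_def)
next
  fix G assume G: "G \<in> link \<Delta> F"
  then show "finite G"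
    using assms(1) by (auto simp: abstract_complex_def link_def)
  fix H assume "H \<subseteq> G"
  then have "H \<union> F \<subseteq> G \<union> F" "H \<inter> F \<subseteq> G \<inter> F" by auto
  moreover have "G \<in> \<Delta>" "G \<union> F \<in> \<Delta>" "G \<inter> F = {}"
    using G by (auto simp: link_def)
  ultimately have "H \<in> \<Delta>" "H \<union> F \<in> \<Delta>" "H \<inter> F = {}"
    using \<open>H \<subseteq> G\<close> assms(1) unfolding abstract_complex_def by (blast, blast, blast)
  then show "H \<in> link \<Delta> F"
    by (simp add: link_def)
qed

text \<open>Double counting of pairs (v, F) with v in F and |F| = j + 1: adding v is a bijection
  from the j-element faces of the link of v to the faces of size j + 1 containing v.\<close>

lemma sum_card_link_faces:
  assumes "abstract_complex \<Delta>"
  shows "(\<Sum>v | {v} \<in> \<Delta>. card {G \<in> link \<Delta> {v}. card G = j}) = (j + 1) * card {F \<in> \<Delta>. card F = j + 1}"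
proof -
  have fin: "finite \<Delta>" "\<And>F. F \<in> \<Delta> \<Longrightarrow> finite F"
    and sub: "\<And>F G. F \<in> \<Delta> \<Longrightarrow> G \<subseteq> F \<Longrightarrow> G \<in> \<Delta>"
    using assms by (auto simp: abstract_complex_def)
  let ?V = "{v. {v} \<in> \<Delta>}"
  have finV: "finite ?V"
    using fin(1) by (rule finite_subset[rotated, OF finite_vimageI[where h = "\<lambda>v. {v}"]]) auto
  have "card {G \<in> link \<Delta> {v}. card G = j} = card {F \<in> {F \<in> \<Delta>. card F = j + 1}. v \<in> F}" for v
  proof (rule bij_betw_same_card[of "insert v"], rule bij_betw_byWitness[where f' = "\<lambda>F. F - {v}"])
    show "insert v ` {G \<in> link \<Delta> {v}. card G = j} \<subseteq> {F \<in> {F \<in> \<Delta>. card F = j + 1}. v \<in> F}"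
      using fin(2) by (auto simp: link_def card_insert_if)
    show "(\<lambda>F. F - {v}) ` {F \<in> {F \<in> \<Delta>. card F = j + 1}. v \<in> F} \<subseteq> {G \<in> link \<Delta> {v}. card G = j}"
      using fin(2) by (auto simp: link_def insert_absorb intro: sub)
  qed (auto simp: link_def)
  then have "(\<Sum>v\<in>?V. card {G \<in> link \<Delta> {v}. card G = j})
      = (\<Sum>v\<in>?V. card {F \<in> {F \<in> \<Delta>. card F = j + 1}. v \<in> F})"
    by simp
  also have "\<dots> = (j + 1) * card {F \<in> \<Delta>. card F = j + 1}"
  proof (rule sum_multicount)
    show "\<forall>F\<in>{F \<in> \<Delta>. card F = j + 1}. card {v \<in> ?V. v \<in> F} = j + 1"
    proof
      fix F assume F: "F \<in> {F \<in> \<Delta>. card F = j + 1}"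
      then have "{v \<in> ?V. v \<in> F} = F"
        by (auto intro: sub)
      with F show "card {v \<in> ?V. v \<in> F} = j + 1" by simp
    qed
  qed (use finV fin in auto)
  finally show ?thesis .
qed

text \<open>In the induction step, apply the hypothesis to
  each vertex link and bound one factor \<open>a\<^bsub>k+1\<^esub>(lk v)\<close> by \<open>a\<^bsub>k+1\<^esub>(\<Delta>)\<close>.\<close>

lemma card_faces_power_le:
  assumes "abstract_complex \<Delta>"
  shows "card {F \<in> \<Delta>. card F = k + 1} ^ k \<le> card {F \<in> \<Delta>. card F = k} ^ (k + 1)"
  using assms
proof (induction k arbitrary: \<Delta>)
  case 0
  then show ?case
    using f_num_minus_one[OF 0] f_num_int_minus_one[of \<Delta> 0] by (simp flip: One_nat_def)
next
  case (Suc k)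
  define a where "a \<Gamma> j = card {F \<in> \<Gamma>. card F = j}" for \<Gamma> :: "'a set set" and j
  \<comment> \<open>The bound on each link is an inequality of (k+1)-st powers; its root is linear
    in the face number of the link and can be summed over the vertices.\<close>
  define r where "r = root (k + 1) (a \<Delta> (k + 1))"
  have r: "r \<ge> 0" "r ^ (k + 1) = a \<Delta> (k + 1)"
    unfolding r_def by (simp, intro real_root_pow_pos2) auto
  have link_le: "real (a (link \<Delta> {v}) (k + 1)) \<le> r * a (link \<Delta> {v}) k" if "{v} \<in> \<Delta>" for v
  proof -
    have "a (link \<Delta> {v}) (k + 1) ^ k \<le> a (link \<Delta> {v}) k ^ (k + 1)"
      unfolding a_def using Suc.IH abstract_complex_link[OF Suc.prems that] by blast
    moreover have "a (link \<Delta> {v}) (k + 1) \<le> a \<Delta> (k + 1)"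
      unfolding a_def using Suc.prems by (intro card_mono) (auto simp: abstract_complex_def link_def)
    ultimately have "a (link \<Delta> {v}) (k + 1) ^ (k + 1) \<le> a \<Delta> (k + 1) * a (link \<Delta> {v}) k ^ (k + 1)"
      by (simp add: mult_mono del: power_Suc add: power_Suc[of _ k])
    then have "real (a (link \<Delta> {v}) (k + 1)) ^ (k + 1) \<le> a \<Delta> (k + 1) * real (a (link \<Delta> {v}) k) ^ (k + 1)"
      by (metis of_nat_le_iff of_nat_mult of_nat_power)
    also have "\<dots> = (r * a (link \<Delta> {v}) k) ^ (k + 1)"
      unfolding power_mult_distrib r(2) ..
    finally show ?thesis
      by (subst (asm) power_mono_iff) (use r(1) in auto)
  qed
  have "(real k + 2) * a \<Delta> (k + 2) = (\<Sum>v | {v} \<in> \<Delta>. real (a (link \<Delta> {v}) (k + 1)))"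
    using arg_cong[OF sum_card_link_faces[OF Suc.prems, of "k + 1"], of real]
    by (simp add: a_def distrib_right)
  also have "\<dots> \<le> (\<Sum>v | {v} \<in> \<Delta>. r * a (link \<Delta> {v}) k)"
    using link_le by (intro sum_mono) simp
  also have "\<dots> = r * ((real k + 1) * a \<Delta> (k + 1))"
    using arg_cong[OF sum_card_link_faces[OF Suc.prems, of k], of real]
    by (simp add: a_def distrib_right flip: sum_distrib_left)
  \<comment> \<open>Weakening k+1 to k+2 gives both sides the same factor, which then
    cancels.\<close>
  also have "\<dots> \<le> r * ((real k + 2) * a \<Delta> (k + 1))"
    using r(1) by (intro mult_left_mono mult_right_mono) auto
  finally have "(real k + 2) * a \<Delta> (k + 2) \<le> (real k + 2) * (r * a \<Delta> (k + 1))"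
    by (simp add: mult_ac)
  then have "real (a \<Delta> (k + 2)) \<le> r * a \<Delta> (k + 1)"
    by (subst (asm) mult_le_cancel_left_pos) auto
  then have "real (a \<Delta> (k + 2)) ^ (k + 1) \<le> (r * a \<Delta> (k + 1)) ^ (k + 1)"
    by (intro power_mono) auto
  also have "\<dots> = real (a \<Delta> (k + 1)) ^ (k + 2)"
    unfolding power_mult_distrib r(2) by simp
  finally have "a \<Delta> (k + 2) ^ (k + 1) \<le> a \<Delta> (k + 1) ^ (k + 2)"
    by (metis of_nat_le_iff of_nat_power)
  then show ?case
    by (simp add: a_def)
qed

section \<open>A power bound for consecutive g-numbers\<close>

text \<open>g_(k+1) \<le> h_(k+1), which is f_k up to an error. The power bound on faces and f_(k-1)
  = O(g_k) control f_k; the error is O(d g_k), and d = O(g_k^(1/k)).\<close>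

lemma g_num_Suc_le_powr:
  assumes "k \<ge> 1"
  shows "\<exists>B>0. \<forall>d (\<Delta> :: 'a set set). abstract_complex \<Delta> \<and> gamma_nonneg d \<Delta> \<and> 4 * k \<le> d \<and> 2 * k + 2 \<le> d \<longrightarrow>
     g_num d \<Delta> (k + 1) \<le> B * g_num d \<Delta> k powr ((real k + 1) / real k)"
proof -
  have "\<exists>A. \<forall>j. A j \<ge> (0::real) \<and> (\<forall>d (\<Delta> :: 'a set set). abstract_complex \<Delta> \<and> gamma_nonneg d \<Delta> \<and> 4 * j \<le> d + 2 \<longrightarrow>
     real (f_num \<Delta> (int j - 1)) \<le> A j * g_num d \<Delta> j)"
    using f_num_le_g_num by metis
  then obtain A where A: "\<And>i. A i \<ge> (0::real)"
    "\<And>i d \<Delta>. abstract_complex (\<Delta> :: 'a set set) \<Longrightarrow> gamma_nonneg d \<Delta> \<Longrightarrow> 4 * i \<le> d + 2 \<Longrightarrow>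
       real (f_num \<Delta> (int i - 1)) \<le> A i * g_num d \<Delta> i"
    by blast
  define p where "p = (real k + 1) / real k"
  define S where "S = (\<Sum>i\<le>k. A i * (2 * real k) ^ (k - i))"
  \<comment> \<open>The summands stem from f_k, from the error term, and from the need for
    \<open>B > 0\<close>.\<close>
  define B where "B = A k powr p + 2 * real k * S + 1"
  have S0: "S \<ge> 0" unfolding S_def using A(1) by (intro sum_nonneg) auto
  have p: "p > 0" "p = 1 + 1 / real k" using assms by (auto simp: p_def field_simps)
  have "g_num d \<Delta> (k + 1) \<le> B * g_num d \<Delta> k powr p"
    if \<Delta>: "abstract_complex \<Delta>" "gamma_nonneg d \<Delta>" and d: "4 * k \<le> d" "2 * k + 2 \<le> d"
    for d and \<Delta> :: "'a set set"
  proof -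
    define x where "x = real_of_int (g_num d \<Delta> k)"
    have x: "x > 0" unfolding x_def using g_num_pos[OF \<Delta>, of k] d by simp
    have growth: "real d ^ (k - i) * g_num d \<Delta> i \<le> (2 * real k) ^ (k - i) * x" if "i \<le> k" for i
      unfolding x_def using g_num_power_growth[OF \<Delta> _ that] d by simp
    \<comment> \<open>Power growth from g_0 = 1 bounds the dimension by a k-th root of g_k.\<close>
    have "real d ^ k \<le> (2 * real k) ^ k * x"
      using growth[of 0] by (simp add: g_num_def)
    also have "\<dots> = (2 * real k * x powr (1 / real k)) ^ k"
      using x assms by (simp add: power_mult_distrib powr_powr flip: powr_realpow)
    finally have d_le: "real d \<le> 2 * real k * x powr (1 / real k)"
      using assms by (simp add: power_mono_iff)
    have "(real (f_num \<Delta> (int (k + 1) - 1))) ^ k \<le> real (f_num \<Delta> (int k - 1)) ^ (k + 1)"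
      unfolding f_num_int_minus_one of_nat_power[symmetric] of_nat_le_iff
      by (rule card_faces_power_le[OF \<Delta>(1)])
    also have "\<dots> \<le> (A k * x) ^ (k + 1)"
      unfolding x_def using d by (intro power_mono A(2) \<Delta>) auto
    finally have "root k (real (f_num \<Delta> (int (k + 1) - 1)) ^ k) \<le> root k ((A k * x) ^ (k + 1))"
      using assms by (intro real_root_le_mono) auto
    also have "root k (real (f_num \<Delta> (int (k + 1) - 1)) ^ k) = real (f_num \<Delta> (int (k + 1) - 1))"
      using assms by (intro real_root_power_cancel) auto
    also have "root k ((A k * x) ^ (k + 1)) = (A k * x) powr p"
    \<comment> \<open>\<open>powr_realpow\<close> requires a positive base; for base 0 both sides
      are 0.\<close>
    proof (cases "A k = 0")
      case False
      then have "A k * x > 0" using A(1)[of k] x by simp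
      then have "(A k * x) ^ (k + 1) = (A k * x) powr (real k + 1)"
        using powr_realpow[of "A k * x" "k + 1"] by (simp add: add.commute)
      then show ?thesis
        using assms \<open>A k * x > 0\<close> by (simp add: root_powr_inverse powr_powr p_def)
    qed (use assms in simp)
    also have "\<dots> = A k powr p * x powr p"
      using A(1) x by (simp add: powr_mult)
    finally have f: "real (f_num \<Delta> (int (k + 1) - 1)) \<le> A k powr p * x powr p" .
    \<comment> \<open>Each term has one more power of d than growth up to g_k absorbs; this d is
      split off and later exchanged for \<open>x powr (1 / real k)\<close>.\<close>
    have "(\<Sum>i<k + 1. real d ^ (k + 1 - i) * real (f_num \<Delta> (int i - 1))) \<le> (\<Sum>i\<le>k. real d * (A i * (2 * real k) ^ (k - i) * x))"
      unfolding Suc_eq_plus1[symmetric] lessThan_Suc_atMost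
    proof (rule sum_mono)
      fix i assume i: "i \<in> {..k}"
      have "real d ^ (k - i) * real (f_num \<Delta> (int i - 1)) \<le> real d ^ (k - i) * (A i * g_num d \<Delta> i)"
        using i d \<Delta> by (intro mult_left_mono A(2)) auto
      also have "\<dots> = A i * (real d ^ (k - i) * g_num d \<Delta> i)" by simp
      also have "\<dots> \<le> A i * ((2 * real k) ^ (k - i) * x)"
        using A(1) i growth by (intro mult_left_mono) auto
      finally have "real d * (real d ^ (k - i) * real (f_num \<Delta> (int i - 1))) \<le> real d * (A i * ((2 * real k) ^ (k - i) * x))"
        by (intro mult_left_mono) auto
      then show "real d ^ (Suc k - i) * real (f_num \<Delta> (int i - 1)) \<le> real d * (A i * (2 * real k) ^ (k - i) * x)"
        using i by (simp add: Suc_diff_le mult_ac)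
    qed
    also have "\<dots> = real d * (S * x)"
      by (simp add: S_def sum_distrib_left sum_distrib_right)
    also have "\<dots> \<le> 2 * real k * x powr (1 / real k) * (S * x)"
      using d_le S0 x by (intro mult_right_mono) auto
    also have "\<dots> = 2 * real k * S * x powr p"
      using x by (simp add: p(2) powr_add)
    finally have rest: "(\<Sum>i<k + 1. real d ^ (k + 1 - i) * real (f_num \<Delta> (int i - 1))) \<le> 2 * real k * S * x powr p" .
    have "g_num d \<Delta> (k + 1) \<le> h_num d \<Delta> (k + 1)"
    proof -
      have "0 \<le> h_num d \<Delta> k"
        unfolding sum_g_num[OF \<Delta>(1), symmetric]
        using d by (intro sum_nonneg less_imp_le g_num_pos[OF \<Delta>]) auto
      then show ?thesis by (simp add: g_num_def)
    qed
    then have "real_of_int (g_num d \<Delta> (k + 1)) \<le> real_of_int (h_num d \<Delta> (k + 1))"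
      by simp
    also have "\<dots> \<le> A k powr p * x powr p + 2 * real k * S * x powr p"
      using h_num_f_num_diff[of d \<Delta> "k + 1"] f rest by linarith
    also have "\<dots> \<le> B * x powr p"
      by (simp add: B_def distrib_right)
    finally show ?thesis by (simp add: x_def)
  qed
  moreover have "B > 0"
    unfolding B_def using S0 by (intro add_nonneg_pos add_nonneg_nonneg) auto
  ultimately show ?thesis
    unfolding p_def by blast
qed

section \<open>Asymptotics of the normalized C_k\<close>

text \<open>As d \<ge> 4, both g_1 and g_2 are positive, so f_1 is at least C(d+1,2).\<close>

lemma f_num_1_ge:
  assumes "abstract_complex \<Delta>" "gamma_nonneg d \<Delta>" "d \<ge> 4"
  shows "(real d)\<^sup>2 / 2 \<le> real (f_num \<Delta> 1)"
proof -
  have "2 * ((d + 1) choose 2) = (d + 1) * d"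
    unfolding choose_two by (simp add: mult.commute)
  then have "2 * int ((d + 1) choose 2) = (int d + 1) * int d"
    by (metis of_nat_1 of_nat_add of_nat_mult of_nat_numeral)
  moreover have "g_num d \<Delta> 2 > 0" "int d * g_num d \<Delta> 1 \<ge> 0"
    using g_num_pos[OF assms(1,2), of 1] g_num_pos[OF assms(1,2), of 2] assms(3) by auto
  ultimately have "int d * int d \<le> 2 * int (f_num \<Delta> 1)"
    using f_num_1_eq[OF assms(1), of d] assms(3) by (simp add: algebra_simps)
  then have "real_of_int (int d * int d) \<le> real_of_int (2 * int (f_num \<Delta> 1))"
    by (simp only: of_int_le_iff)
  then show ?thesis by (simp add: power2_eq_square)
qed

text \<open>Separates the term with g_(m+2), which survives in the limit, from the two that
  vanish.\<close>

lemma C_num_div_eq: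
  assumes "g_num d \<Delta> (m + 1) \<noteq> 0"
  shows "1 / real (f_num \<Delta> 1) * (C_num d \<Delta> m / g_num d \<Delta> (m + 1)) =
    1 / 2 * (((real m + 1) * (real m + 2) * (g_num d \<Delta> (m + 2) / g_num d \<Delta> (m + 1))) / real (f_num \<Delta> 1))
    + ((real m + 1) * (real d - real m) / real (f_num \<Delta> 1)
      + (real d - real m) * (real d - real m + 1) * (g_num d \<Delta> m / g_num d \<Delta> (m + 1)) / (2 * real (f_num \<Delta> 1)))"
  using assms by (cases "f_num \<Delta> 1 = 0") (simp_all add: C_num_def field_simps)

lemma tendsto_C_num_remainder:
  fixes \<Delta> :: "nat \<Rightarrow> 'a set set"
  assumes "\<forall>\<^sub>F d in sequentially. abstract_complex (\<Delta> d) \<and> gamma_nonneg d (\<Delta> d)"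
  shows "(\<lambda>d. (real m + 1) * (real d - real m) / real (f_num (\<Delta> d) 1)
      + (real d - real m) * (real d - real m + 1) * (g_num d (\<Delta> d) m / g_num d (\<Delta> d) (m + 1))
          / (2 * real (f_num (\<Delta> d) 1))) \<longlonglongrightarrow> 0" (is "?R \<longlonglongrightarrow> 0")
proof (rule tendsto_sandwich)
  \<comment> \<open>The terms are at most (m+1)d/f_1 and 2(m+1)d/f_1, the second since (d-m)(d-m+1)
    \<le> 2d^2 and d g_m/g_(m+1) \<le> 2(m+1). With f_1 \<ge> d^2/2 the total is at most
    6(m+1)/d.\<close>
  have *: "\<forall>\<^sub>F d in sequentially. 0 \<le> ?R d \<and> ?R d \<le> 6 * (real m + 1) / real d"
    using assms eventually_ge_at_top[of "4 * m + 4"]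
  proof eventually_elim
    case (elim d)
    then have \<Delta>: "abstract_complex (\<Delta> d)" "gamma_nonneg d (\<Delta> d)" and d: "d \<ge> 4 * m + 4" by auto
    define F where "F = real (f_num (\<Delta> d) 1)"
    define q where "q = real_of_int (g_num d (\<Delta> d) m) / g_num d (\<Delta> d) (m + 1)"
    have F: "(real d)\<^sup>2 / 2 \<le> F" unfolding F_def using f_num_1_ge[OF \<Delta>] d by simp
    have d0: "real d \<ge> 1" "real d \<ge> real m" using d by auto
    then have F0: "F > 0" using F by (smt (verit) one_le_power half_gt_zero)
    have g: "g_num d (\<Delta> d) m > 0" "g_num d (\<Delta> d) (m + 1) > 0"
      using d by (auto intro!: g_num_pos[OF \<Delta>])
    then have q0: "q \<ge> 0" by (simp add: q_def)
    have q: "real d * q \<le> 2 * (real m + 1)"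
      using g_num_growth_real[OF \<Delta>, of m] d g(2) by (simp add: q_def field_simps)
    have "(real d - real m) * (real d - real m + 1) * q \<le> (real d * (2 * real d)) * q"
      using d0 q0 by (intro mult_right_mono mult_mono) auto
    also have "\<dots> = (real d * q) * (2 * real d)"
      by simp
    also have "\<dots> \<le> 2 * (real m + 1) * (2 * real d)"
      using q by (intro mult_right_mono) auto
    finally have b: "(real d - real m) * (real d - real m + 1) * q \<le> 4 * (real m + 1) * real d"
      by (simp add: algebra_simps)
    have "(real m + 1) * (real d - real m) / F + (real d - real m) * (real d - real m + 1) * q / (2 * F)
      \<le> (real m + 1) * real d / F + 4 * (real m + 1) * real d / (2 * F)"
      using b F0 by (intro add_mono divide_right_mono mult_left_mono) auto
    also have "\<dots> = 3 * (real m + 1) * real d / F"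
      using F0 by (simp add: field_simps)
    also have "\<dots> \<le> 3 * (real m + 1) * real d / ((real d)\<^sup>2 / 2)"
      using F F0 d0 by (intro divide_left_mono) auto
    also have "\<dots> = 6 * (real m + 1) / real d"
      using d0 by (simp add: field_simps power2_eq_square)
    finally have "?R d \<le> 6 * (real m + 1) / real d"
      by (simp add: F_def q_def)
    moreover have "0 \<le> (real m + 1) * (real d - real m) / F + (real d - real m) * (real d - real m + 1) * q / (2 * F)"
      using d0 q0 F0 by (intro add_nonneg_nonneg divide_nonneg_nonneg mult_nonneg_nonneg) auto
    ultimately show ?case
      by (simp add: F_def q_def)
  qed
  then show "\<forall>\<^sub>F d in sequentially. 0 \<le> ?R d" "\<forall>\<^sub>F d in sequentially. ?R d \<le> 6 * (real m + 1) / real d"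
    by (auto elim: eventually_mono)
  show "(\<lambda>d. 6 * (real m + 1) / real d) \<longlonglongrightarrow> 0"
    by (rule lim_const_over_n)
qed simp

text \<open>The two sequences eventually differ by the vanishing remainder. The case m = k is the
  first claim; m = k - 1 controls the bracket on the right of the second.\<close>

lemma C_num_quotient_tendsto_iff:
  fixes \<Delta> :: "nat \<Rightarrow> 'a set set"
  assumes ev: "\<forall>\<^sub>F d in sequentially. abstract_complex (\<Delta> d) \<and> gamma_nonneg d (\<Delta> d)"
  shows "((\<lambda>d. 1 / real (f_num (\<Delta> d) 1) * (C_num d (\<Delta> d) m / real_of_int (g_num d (\<Delta> d) (m + 1)))) \<longlonglongrightarrow> L)
    \<longleftrightarrow> ((\<lambda>d. 1 / 2 * (((real m + 1) * (real m + 2)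
            * (real_of_int (g_num d (\<Delta> d) (m + 2)) / real_of_int (g_num d (\<Delta> d) (m + 1))))
          / real (f_num (\<Delta> d) 1))) \<longlonglongrightarrow> L)" (is "(?C \<longlonglongrightarrow> L) \<longleftrightarrow> (?M \<longlonglongrightarrow> L)")
proof -
  let ?R = "\<lambda>d. (real m + 1) * (real d - real m) / real (f_num (\<Delta> d) 1)
      + (real d - real m) * (real d - real m + 1) * (g_num d (\<Delta> d) m / g_num d (\<Delta> d) (m + 1))
          / (2 * real (f_num (\<Delta> d) 1))"
  have "\<forall>\<^sub>F d in sequentially. ?R d = ?C d - ?M d"
    using ev eventually_ge_at_top[of "2 * m + 2"]
  proof eventually_elim
    case (elim d)
    then have "g_num d (\<Delta> d) (m + 1) > 0" by (intro g_num_pos) auto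
    then show ?case by (subst C_num_div_eq) auto
  qed
  then have "(\<lambda>d. ?C d - ?M d) \<longlonglongrightarrow> 0"
    by (rule Lim_transform_eventually[OF tendsto_C_num_remainder[OF ev]])
  then show ?thesis
    by (rule Lim_transform_eq)
qed

section \<open>The limit equivalence and the eventual inequality\<close>

theorem theorem2p36:
  fixes k :: nat
  assumes "k \<ge> 1"
  shows
    "(\<forall>\<Delta> :: nat \<Rightarrow> 'a set set.
        (\<forall>d\<ge>2 * k + 4. simplicial_sphere (d - 1) (\<Delta> d) \<and> link_condition (\<Delta> d)
            \<and> gamma_nonneg d (\<Delta> d)) \<and>
        (\<lambda>d. real d) \<in> o(\<lambda>d. real_of_int (g_num d (\<Delta> d) 1))
      \<longrightarrow>
        (\<forall>L :: real.
           ((\<lambda>d. 1 / real (f_num (\<Delta> d) 1)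
                * (C_num d (\<Delta> d) k / real_of_int (g_num d (\<Delta> d) (k + 1)))) \<longlonglongrightarrow> L)
           \<longleftrightarrow>
           ((\<lambda>d. 1 / 2 * (((real k + 1) * (real k + 2)
                  * (real_of_int (g_num d (\<Delta> d) (k + 2)) / real_of_int (g_num d (\<Delta> d) (k + 1))))
                / real (f_num (\<Delta> d) 1))) \<longlonglongrightarrow> L)))
     \<and>
     (\<forall>\<Delta> :: nat \<Rightarrow> 'a set set.
        (\<forall>d\<ge>2 * k + 4. simplicial_sphere (d - 1) (\<Delta> d) \<and> gamma_nonneg d (\<Delta> d)) \<and>
        (\<lambda>d. real d) \<in> o(\<lambda>d. real_of_int (g_num d (\<Delta> d) 1)) \<and>
        (\<lambda>d. real_of_int (g_num d (\<Delta> d) (k + 1)) / real_of_int (g_num d (\<Delta> d) k))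
          \<in> o(\<lambda>d. real (f_num (\<Delta> d) 1) / (real d)\<^sup>2)
      \<longrightarrow>
        (\<forall>\<^sub>F d in sequentially.
           1 - 1 / real (f_num (\<Delta> d) 1)
                * (C_num d (\<Delta> d) k / real_of_int (g_num d (\<Delta> d) (k + 1)))
           \<le> real (f_num (\<Delta> d) 1) powr (1 / real k)
              * (real_of_int (g_num d (\<Delta> d) k) powr ((real k + 1) / real k)
                  / real_of_int (g_num d (\<Delta> d) (k + 1)))
              * (1 - 1 / real (f_num (\<Delta> d) 1)
                  * (C_num d (\<Delta> d) (k - 1) / real_of_int (g_num d (\<Delta> d) k)))
                powr ((real k + 1) / real k)))"
proof (intro conjI allI impI)
  fix \<Delta> :: "nat \<Rightarrow> 'a set set" and L :: real
  assume "(\<forall>d\<ge>2 * k + 4. simplicial_sphere (d - 1) (\<Delta> d) \<and> link_condition (\<Delta> d)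
      \<and> gamma_nonneg d (\<Delta> d)) \<and> (\<lambda>d. real d) \<in> o(\<lambda>d. real_of_int (g_num d (\<Delta> d) 1))"
  then have "\<forall>\<^sub>F d in sequentially. abstract_complex (\<Delta> d) \<and> gamma_nonneg d (\<Delta> d)"
    by (auto simp: eventually_sequentially simplicial_sphere_def)
  then show "((\<lambda>d. 1 / real (f_num (\<Delta> d) 1)
        * (C_num d (\<Delta> d) k / real_of_int (g_num d (\<Delta> d) (k + 1)))) \<longlonglongrightarrow> L)
      \<longleftrightarrow> ((\<lambda>d. 1 / 2 * (((real k + 1) * (real k + 2)
          * (real_of_int (g_num d (\<Delta> d) (k + 2)) / real_of_int (g_num d (\<Delta> d) (k + 1))))
        / real (f_num (\<Delta> d) 1))) \<longlonglongrightarrow> L)"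
    by (rule C_num_quotient_tendsto_iff)
next
  fix \<Delta> :: "nat \<Rightarrow> 'a set set"
  assume "(\<forall>d\<ge>2 * k + 4. simplicial_sphere (d - 1) (\<Delta> d) \<and> gamma_nonneg d (\<Delta> d)) \<and>
      (\<lambda>d. real d) \<in> o(\<lambda>d. real_of_int (g_num d (\<Delta> d) 1)) \<and>
      (\<lambda>d. real_of_int (g_num d (\<Delta> d) (k + 1)) / real_of_int (g_num d (\<Delta> d) k))
        \<in> o(\<lambda>d. real (f_num (\<Delta> d) 1) / (real d)\<^sup>2)"
  then have ev: "\<forall>\<^sub>F d in sequentially. abstract_complex (\<Delta> d) \<and> gamma_nonneg d (\<Delta> d)"
    and small: "(\<lambda>d. real_of_int (g_num d (\<Delta> d) (k + 1)) / real_of_int (g_num d (\<Delta> d) k))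
        \<in> o(\<lambda>d. real (f_num (\<Delta> d) 1) / (real d)\<^sup>2)"
    by (auto simp: eventually_sequentially simplicial_sphere_def)
  define F where "F d = real (f_num (\<Delta> d) 1)" for d
  define p where "p = (real k + 1) / real k"
  have "\<forall>\<^sub>F d in sequentially. real d \<le> F d"
    using ev eventually_ge_at_top[of 4]
  proof eventually_elim
    case (elim d)
    then have "real d \<le> (real d)\<^sup>2 / 2"
      by (simp add: power2_eq_square)
    also have "\<dots> \<le> F d"
      using elim unfolding F_def by (intro f_num_1_ge) auto
    finally show ?case .
  qed
  then have F_top: "filterlim F at_top sequentially"
    by (rule filterlim_at_top_mono[OF filterlim_real_sequentially])
  \<comment> \<open>Since f_1/d^2 \<le> f_1, the assumed o(f_1/d^2) gives o(f_1).\<close>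
  have ratio: "(\<lambda>d. (g_num d (\<Delta> d) (k + 1) / g_num d (\<Delta> d) k) / F d) \<longlonglongrightarrow> 0"
  proof -
    have "(\<lambda>d. real (f_num (\<Delta> d) 1) / (real d)\<^sup>2) \<in> O(F)"
    proof (rule bigoI[of _ 1])
      show "\<forall>\<^sub>F d in sequentially. norm (real (f_num (\<Delta> d) 1) / (real d)\<^sup>2) \<le> 1 * norm (F d)"
        using eventually_ge_at_top[of 1]
      proof eventually_elim
        case (elim d)
        then have "1 \<le> (real d)\<^sup>2" by (intro one_le_power) simp
        then have "F d / (real d)\<^sup>2 \<le> F d / 1"
          using elim by (intro divide_left_mono) (auto simp: F_def)
        then show ?case by (simp add: F_def)
      qed
    qed
    with small have "(\<lambda>d. real_of_int (g_num d (\<Delta> d) (k + 1)) / real_of_int (g_num d (\<Delta> d) k)) \<in> o(F)"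
      by (rule landau_o.small_big_trans)
    then show ?thesis by (rule smalloD_tendsto)
  qed
  define m where "m = k - 1"
  have k: "k = m + 1" using assms by (simp add: m_def)
  have "(\<lambda>d. 1 / 2 * (((real m + 1) * (real m + 2)
            * (real_of_int (g_num d (\<Delta> d) (m + 2)) / real_of_int (g_num d (\<Delta> d) (m + 1))))
          / real (f_num (\<Delta> d) 1))) \<longlonglongrightarrow> 0"
    using tendsto_mult_left[OF ratio, of "1 / 2 * ((real m + 1) * (real m + 2))"]
    by (simp add: k F_def mult_ac)
  then have "(\<lambda>d. 1 / real (f_num (\<Delta> d) 1) * (C_num d (\<Delta> d) m / real_of_int (g_num d (\<Delta> d) (m + 1)))) \<longlonglongrightarrow> 0"
    using C_num_quotient_tendsto_iff[OF ev] by blast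
  \<comment> \<open>The bracket on the right of the inequality thus exceeds 1/2, which keeps its
    real power bounded below.\<close>
  then have C_small: "\<forall>\<^sub>F d in sequentially.
      1 / F d * (C_num d (\<Delta> d) (k - 1) / real_of_int (g_num d (\<Delta> d) k)) < 1 / 2"
    unfolding k F_def by (intro order_tendstoD) auto
  obtain B where B: "B > 0" "\<And>d \<Delta>. abstract_complex (\<Delta> :: 'a set set) \<Longrightarrow> gamma_nonneg d \<Delta> \<Longrightarrow>
      4 * k \<le> d \<Longrightarrow> 2 * k + 2 \<le> d \<Longrightarrow> g_num d \<Delta> (k + 1) \<le> B * g_num d \<Delta> k powr p"
    using g_num_Suc_le_powr[OF assms] unfolding p_def by blast
  \<comment> \<open>This threshold lets f_1^(1/k) absorb both \<open>B\<close> and the loss (1/2)^p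
    from the bracket.\<close>
  have "\<forall>\<^sub>F d in sequentially. F d \<ge> (B * 2 powr p) powr real k"
    using F_top by (simp add: filterlim_at_top)
  then have "\<forall>\<^sub>F d in sequentially.
      1 - 1 / F d * (C_num d (\<Delta> d) k / real_of_int (g_num d (\<Delta> d) (k + 1)))
      \<le> F d powr (1 / real k) * (real_of_int (g_num d (\<Delta> d) k) powr p / real_of_int (g_num d (\<Delta> d) (k + 1)))
         * (1 - 1 / F d * (C_num d (\<Delta> d) (k - 1) / real_of_int (g_num d (\<Delta> d) k))) powr p"
    using ev C_small eventually_ge_at_top[of "4 * k + 4"]
  proof eventually_elim
    case (elim d)
    then have \<Delta>: "abstract_complex (\<Delta> d)" "gamma_nonneg d (\<Delta> d)" and d: "d \<ge> 4 * k + 4" by auto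
    define x y where "x = real_of_int (g_num d (\<Delta> d) k)" and "y = real_of_int (g_num d (\<Delta> d) (k + 1))"
    have g: "g_num d (\<Delta> d) j > 0" if "j \<le> k + 2" for j
      using d that by (intro g_num_pos[OF \<Delta>]) auto
    then have xy: "x > 0" "y > 0" by (auto simp: x_def y_def)
    have "C_num d (\<Delta> d) k \<ge> 0"
      unfolding C_num_def using d g[of k] g[of "k + 1"] g[of "k + 2"]
      by (intro mult_nonneg_nonneg add_nonneg_nonneg) auto
    \<comment> \<open>As C_k \<ge> 0 the left side is at most 1, so it suffices to bound the right
      side below by 1.\<close>
    then have "1 - 1 / F d * (C_num d (\<Delta> d) k / y) \<le> 1"
      using xy by (simp add: F_def)
    also have "1 \<le> B * x powr p / y"
      using B(2)[OF \<Delta>] d xy by (simp add: x_def y_def)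
    also have "\<dots> = (B * 2 powr p) * (x powr p / y) * (1 / 2) powr p"
      by (simp add: powr_divide)
    also have "\<dots> \<le> F d powr (1 / real k) * (x powr p / y) * (1 - 1 / F d * (C_num d (\<Delta> d) (k - 1) / x)) powr p"
    proof (intro mult_mono)
      have "B * 2 powr p = ((B * 2 powr p) powr real k) powr (1 / real k)"
        using assms B(1) by (simp add: powr_powr)
      also have "\<dots> \<le> F d powr (1 / real k)"
        using elim by (intro powr_mono2) auto
      finally show "B * 2 powr p \<le> F d powr (1 / real k)" .
      show "(1 / 2) powr p \<le> (1 - 1 / F d * (C_num d (\<Delta> d) (k - 1) / x)) powr p"
        using elim by (intro powr_mono2) (auto simp: p_def x_def)
    qed (use xy B(1) in auto)
    finally show ?case by (simp add: x_def y_def)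
  qed
  then show "\<forall>\<^sub>F d in sequentially.
      1 - 1 / real (f_num (\<Delta> d) 1) * (C_num d (\<Delta> d) k / real_of_int (g_num d (\<Delta> d) (k + 1)))
      \<le> real (f_num (\<Delta> d) 1) powr (1 / real k)
         * (real_of_int (g_num d (\<Delta> d) k) powr ((real k + 1) / real k) / real_of_int (g_num d (\<Delta> d) (k + 1)))
         * (1 - 1 / real (f_num (\<Delta> d) 1) * (C_num d (\<Delta> d) (k - 1) / real_of_int (g_num d (\<Delta> d) k)))
             powr ((real k + 1) / real k)"
    by (simp only: F_def p_def)
qed

end
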